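(* Let $r\ge 2$ and let $s_1,\ldots,s_r$ be positive integers. There exists a constant $C>0$, depending only on $r,s_1,\ldots,s_r$, such that for all positive integers $m_1,\ldots,m_r$ with $m_i\ge m_r$ for all $1\le i\le r-1$, $$z(m_1,m_2,\ldots,m_r;s_1,s_2,\ldots,s_r)\ \le\ C\, m_1m_2\cdots m_{r-1}\, m_r^{\,1-\frac{1}{s_1s_2\cdots s_{r-1}}}.$$
   Context: An $r$-graph $H$ is a pair $(V(H),E(H))$ where $E(H)$ is a collection of $r$-element subsets of the finite set $V(H)$. It is $r$-partite with parts $V_1,\ldots,V_r$ if $V(H)$ is the disjoint union of the $V_i$ and every edge contains exactly one vertex of each $V_i$. $K_{s_1,\ldots,s_r}$ denotes the complete $r$-partite $r$-graph whose $i$-th part has $s_i$ vertices. $H$ contains an ordered $K_{s_1,\ldots,s_r}$ if there are sets $S_i\subseteq V_i$ with $|S_i|=s_i$ for $1\le i\le r$ such that $\{v_1,\ldots,v_r\}\in E(H)$ for all choices $v_i\in S_i$. The Zarankiewicz number $z(m_1,\ldots,m_r;s_1,\ldots,s_r)$ is the maximum number of edges of an $r$-partite $r$-graph whose $i$-th part has $m_i$ vertices ($1\le i\le r$) and which does not contain an ordered $K_{s_1,\ldots,s_r}$. *)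

theory Defs
  imports Complex_Main "HOL-Library.Disjoint_Sets"
begin

type_synonym 'a hypergraph = "'a set \<times> 'a set set"

abbreviation vertices :: "'a hypergraph \<Rightarrow> 'a set" where
  "vertices H \<equiv> fst H"

abbreviation hyperedges :: "'a hypergraph \<Rightarrow> 'a set set" where
  "hyperedges H \<equiv> snd H"

definition r_graph :: "nat \<Rightarrow> 'a hypergraph \<Rightarrow> bool" where
  "r_graph r H \<longleftrightarrow>
     finite (vertices H) \<and> (\<forall>e\<in>hyperedges H. e \<subseteq> vertices H \<and> card e = r)"

(* Families indexed by 1, ..., r (parts, part sizes, ...) are functions on nat of which only the
   values on {1..r} matter. *)

definition r_partite :: "nat \<Rightarrow> 'a hypergraph \<Rightarrow> (nat \<Rightarrow> 'a set) \<Rightarrow> bool" where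
  "r_partite r H V \<longleftrightarrow>
     r_graph r H \<and>
     vertices H = (\<Union>i\<in>{1..r}. V i) \<and> disjoint_family_on V {1..r} \<and>
     (\<forall>e\<in>hyperedges H. \<forall>i\<in>{1..r}. card (e \<inter> V i) = 1)"

definition contains_ordered_complete ::
    "nat \<Rightarrow> 'a hypergraph \<Rightarrow> (nat \<Rightarrow> 'a set) \<Rightarrow> (nat \<Rightarrow> nat) \<Rightarrow> bool" where
  "contains_ordered_complete r H V s \<longleftrightarrow>
     (\<exists>S. (\<forall>i\<in>{1..r}. S i \<subseteq> V i \<and> card (S i) = s i) \<and>
          (\<forall>v. (\<forall>i\<in>{1..r}. v i \<in> S i) \<longrightarrow> v ` {1..r} \<in> hyperedges H))"

definition zarankiewicz_graph ::
    "nat \<Rightarrow> (nat \<Rightarrow> nat) \<Rightarrow> (nat \<Rightarrow> nat) \<Rightarrow> 'a hypergraph \<Rightarrow> (nat \<Rightarrow> 'a set) \<Rightarrow> bool" where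
  "zarankiewicz_graph r m s H V \<longleftrightarrow>
     r_partite r H V \<and> (\<forall>i\<in>{1..r}. card (V i) = m i) \<and>
     \<not> contains_ordered_complete r H V s"

(* Vertices are natural numbers; since the vertex sets are finite this is no restriction, see
   card_hyperedges_le_zarankiewicz below. The maximum is over a finite set, which is nonempty
   when r and all the s i are positive (the edgeless graph qualifies), see
   zarankiewicz_attained. *)
definition zarankiewicz :: "nat \<Rightarrow> (nat \<Rightarrow> nat) \<Rightarrow> (nat \<Rightarrow> nat) \<Rightarrow> nat" where
  "zarankiewicz r m s =
     Max {card (hyperedges H) | (H :: nat hypergraph) V. zarankiewicz_graph r m s H V}"

lemma finite_zarankiewicz:
  "finite {card (hyperedges H) | (H :: 'a hypergraph) V. zarankiewicz_graph r m s H V}"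
proof (rule finite_subset)
  show "{card (hyperedges H) | (H :: 'a hypergraph) V. zarankiewicz_graph r m s H V}
          \<subseteq> {..2 ^ (\<Sum>i=1..r. m i)}"
  proof (rule subsetI, elim CollectE exE conjE)
    fix n and H :: "'a hypergraph" and V
    assume Z: "zarankiewicz_graph r m s H V" and n: "n = card (hyperedges H)"
    from Z have fin: "finite (vertices H)" and sub: "hyperedges H \<subseteq> Pow (vertices H)"
      by (auto simp: zarankiewicz_graph_def r_partite_def r_graph_def)
    have "card (vertices H) \<le> (\<Sum>i=1..r. card (V i))"
      using Z card_UN_le[of "{1..r}" V]
      by (simp add: zarankiewicz_graph_def r_partite_def)
    also have "\<dots> = (\<Sum>i=1..r. m i)"
      using Z by (simp add: zarankiewicz_graph_def)
    finally have *: "card (vertices H) \<le> (\<Sum>i=1..r. m i)" .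
    have "card (hyperedges H) \<le> card (Pow (vertices H))"
      using fin sub by (intro card_mono) auto
    also have "\<dots> = 2 ^ card (vertices H)"
      using fin by (rule card_Pow)
    also have "\<dots> \<le> 2 ^ (\<Sum>i=1..r. m i)"
      using * by (intro power_increasing) auto
    finally show "n \<in> {..2 ^ (\<Sum>i=1..r. m i)}" by (simp add: n)
  qed
qed simp

lemma zarankiewicz_attained:
  assumes "r \<ge> 1" and pos: "\<forall>i\<in>{1..r}. s i > 0"
  shows "\<exists>(H :: nat hypergraph) V.
           zarankiewicz_graph r m s H V \<and> card (hyperedges H) = zarankiewicz r m s"
proof -
  define V where "V i = (\<lambda>k. k * Suc r + i) ` {..<m i}" for i
  have card: "card (V i) = m i" for i
    unfolding V_def by (subst card_image) (auto intro!: inj_onI simp del: mult_Suc_right)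
  have mod: "x mod Suc r = i" if "x \<in> V i" "i \<in> {1..r}" for x i
  proof -
    from that obtain k where k: "x = k * Suc r + i" by (auto simp: V_def)
    show ?thesis unfolding k using that(2) by (subst mod_mult_self3) simp
  qed
  have disj: "disjoint_family_on V {1..r}"
    unfolding disjoint_family_on_def using mod by blast
  have "\<not> contains_ordered_complete r ((\<Union>i\<in>{1..r}. V i), {}) V s"
  proof
    assume "contains_ordered_complete r ((\<Union>i\<in>{1..r}. V i), {}) V s"
    then obtain S :: "nat \<Rightarrow> nat set" where S: "\<And>i. i \<in> {1..r} \<Longrightarrow> card (S i) = s i"
      and no: "\<And>v. \<not> (\<forall>i\<in>{1..r}. v i \<in> S i)"
      unfolding contains_ordered_complete_def snd_conv empty_iff by metis
    have "\<exists>x. x \<in> S i" if "i \<in> {1..r}" for i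
    proof -
      have "card (S i) \<noteq> 0" using S[OF that] pos that by simp
      then have "S i \<noteq> {}" by (metis card.empty)
      then show ?thesis by blast
    qed
    then have "\<forall>i\<in>{1..r}. (SOME x. x \<in> S i) \<in> S i"
      by (meson someI_ex)
    with no[of "\<lambda>i. SOME x. x \<in> S i"] show False by simp
  qed
  then have "zarankiewicz_graph r m s ((\<Union>i\<in>{1..r}. V i), {}) V"
    using card disj
    by (auto simp: zarankiewicz_graph_def r_partite_def r_graph_def V_def)
  then have "{card (hyperedges H) | (H :: nat hypergraph) V. zarankiewicz_graph r m s H V} \<noteq> {}"
    by blast
  from Max_in[OF finite_zarankiewicz this] show ?thesis
    unfolding zarankiewicz_def by fastforce
qed

lemma card_hyperedges_le_zarankiewicz:
  fixes H :: "'a hypergraph"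
  assumes Z: "zarankiewicz_graph r m s H V"
  shows "card (hyperedges H) \<le> zarankiewicz r m s"
proof -
  have fin: "finite (vertices H)" and eV: "\<And>e. e \<in> hyperedges H \<Longrightarrow> e \<subseteq> vertices H"
    and ce: "\<And>e. e \<in> hyperedges H \<Longrightarrow> card e = r"
    and VH: "vertices H = (\<Union>i\<in>{1..r}. V i)" and disj: "disjoint_family_on V {1..r}"
    and ei: "\<And>e i. e \<in> hyperedges H \<Longrightarrow> i \<in> {1..r} \<Longrightarrow> card (e \<inter> V i) = 1"
    and cV: "\<And>i. i \<in> {1..r} \<Longrightarrow> card (V i) = m i"
    and nc: "\<not> contains_ordered_complete r H V s"
    using Z unfolding zarankiewicz_graph_def r_partite_def r_graph_def by blast+
  obtain f :: "'a \<Rightarrow> nat" where f: "inj_on f (vertices H)"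
    using finite_imp_inj_to_nat_seg[OF fin] by blast
  have sub: "V i \<subseteq> vertices H" if "i \<in> {1..r}" for i using that VH by auto
  define H' where "H' = (f ` vertices H, (`) f ` hyperedges H)"
  define V' where "V' i = f ` V i" for i
  have Int: "f ` A \<inter> f ` B = f ` (A \<inter> B)" if "A \<subseteq> vertices H" "B \<subseteq> vertices H" for A B
    using inj_on_image_Int[OF f that] by simp
  have inj: "inj_on f A" if "A \<subseteq> vertices H" for A
    using f that by (rule inj_on_subset)
  have c: "card (f ` A) = card A" if "A \<subseteq> vertices H" for A
    using inj[OF that] by (rule card_image)
  have "r_graph r H'"
    unfolding r_graph_def H'_def using fin eV ce c by fastforce
  moreover have "vertices H' = (\<Union>i\<in>{1..r}. V' i)"
    unfolding H'_def V'_def VH by auto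
  moreover have "disjoint_family_on V' {1..r}"
    using disj unfolding disjoint_family_on_def V'_def by (simp add: Int sub)
  moreover have "\<forall>e\<in>hyperedges H'. \<forall>i\<in>{1..r}. card (e \<inter> V' i) = 1"
  proof clarify
    fix e' i assume "e' \<in> hyperedges H'" and i: "i \<in> {1..r}"
    then obtain e where e: "e \<in> hyperedges H" "e' = f ` e" by (auto simp: H'_def)
    have "e' \<inter> V' i = f ` (e \<inter> V i)"
      using Int[OF eV[OF e(1)] sub[OF i]] e(2) by (simp add: V'_def)
    moreover have "e \<inter> V i \<subseteq> vertices H" using sub[OF i] by auto
    ultimately show "card (e' \<inter> V' i) = 1" using ei[OF e(1) i] c by simp
  qed
  moreover have "\<forall>i\<in>{1..r}. card (V' i) = m i"
    using cV sub c by (simp add: V'_def)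
  moreover have "\<not> contains_ordered_complete r H' V' s"
  proof
    assume "contains_ordered_complete r H' V' s"
    then obtain S' where S': "\<And>i. i \<in> {1..r} \<Longrightarrow> S' i \<subseteq> f ` V i \<and> card (S' i) = s i"
      and E': "\<And>v. \<forall>i\<in>{1..r}. v i \<in> S' i \<Longrightarrow> v ` {1..r} \<in> hyperedges H'"
      unfolding contains_ordered_complete_def V'_def by blast
    define S where "S i = {x \<in> V i. f x \<in> S' i}" for i
    have "S i \<subseteq> V i \<and> card (S i) = s i" if i: "i \<in> {1..r}" for i
    proof -
      have "f ` S i = S' i" using S'[OF i] by (auto simp: S_def)
      moreover have "S i \<subseteq> vertices H" using sub[OF i] by (auto simp: S_def)
      ultimately show ?thesis using c[of "S i"] S'[OF i] by (auto simp: S_def)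
    qed
    moreover have "v ` {1..r} \<in> hyperedges H" if v: "\<forall>i\<in>{1..r}. v i \<in> S i" for v
    proof -
      have "(f \<circ> v) ` {1..r} \<in> hyperedges H'"
        using v by (intro E') (auto simp: S_def)
      then obtain e where e: "e \<in> hyperedges H" "f ` (v ` {1..r}) = f ` e"
        by (auto simp: H'_def image_comp)
      moreover have "v ` {1..r} \<subseteq> vertices H" using v sub by (fastforce simp: S_def)
      ultimately have "v ` {1..r} = e"
        using inj_on_image_eq_iff[OF f _ eV[OF e(1)]] by simp
      with e show ?thesis by simp
    qed
    ultimately have "contains_ordered_complete r H V s"
      unfolding contains_ordered_complete_def by blast
    with nc show False by simp
  qed
  ultimately have "zarankiewicz_graph r m s H' V'"
    by (simp add: zarankiewicz_graph_def r_partite_def)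
  then have "card (hyperedges H') \<le> zarankiewicz r m s"
    unfolding zarankiewicz_def by (intro Max_ge finite_zarankiewicz) blast
  moreover have "inj_on ((`) f) (hyperedges H)"
    by (intro inj_onI) (simp add: inj_on_image_eq_iff[OF f] eV)
  then have "card (hyperedges H') = card (hyperedges H)"
    by (simp add: H'_def card_image)
  ultimately show ?thesis by simp
qed

end

theory Submission
  imports Defs "HOL-Analysis.Convex"
begin

text \<open>Count pairs of a vertex \<open>y\<close> of the last part and a (possibly degenerate) complete
  $(r-1)$-partite block with part sizes $s_1, \ldots, s_{r-1}$ in the link of \<open>y\<close>. By Jensen's
  inequality a random block is complete in the link of a random \<open>y\<close> with probability at least
  $p^{s_1 \cdots s_{r-1}}$, where \<open>p\<close> is the edge density. Conversely a nondegenerate block lies in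
  fewer than $s_r$ links, and degenerate blocks are so rare that they add only a constant to the
  expected number of links. Hence $m_r p^{s_1 \cdots s_{r-1}}$ is bounded.\<close>

section \<open>Uniform averages\<close>

text \<open>The expectation of \<open>f\<close> under the uniform distribution on \<open>A\<close>.
  Since division by 0 gives 0, linearity and the exchange of averages hold for every
  \<open>A\<close>, even an empty or infinite one.\<close>

definition avg :: "'a set \<Rightarrow> ('a \<Rightarrow> real) \<Rightarrow> real" where
  "avg A f = (\<Sum>x\<in>A. f x) / card A"

lemma avg_cong: "A = B \<Longrightarrow> (\<And>x. x \<in> B \<Longrightarrow> f x = g x) \<Longrightarrow> avg A f = avg B g"
  by (simp add: avg_def cong: sum.cong)

lemma avg_const: "finite A \<Longrightarrow> A \<noteq> {} \<Longrightarrow> avg A (\<lambda>_. c) = c"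
  by (simp add: avg_def)

lemma avg_mono: "(\<And>x. x \<in> A \<Longrightarrow> f x \<le> g x) \<Longrightarrow> avg A f \<le> avg A g"
  by (auto simp: avg_def intro!: divide_right_mono sum_mono)

lemma avg_nonneg: "(\<And>x. x \<in> A \<Longrightarrow> 0 \<le> f x) \<Longrightarrow> 0 \<le> avg A f"
  by (simp add: avg_def sum_nonneg)

lemma avg_add: "avg A (\<lambda>x. f x + g x) = avg A f + avg A g"
  by (simp add: avg_def sum.distrib add_divide_distrib)

lemma avg_cmult: "avg A (\<lambda>x. c * f x) = c * avg A f"
  by (simp add: avg_def sum_distrib_left)

lemma avg_multc: "avg A (\<lambda>x. f x * c) = avg A f * c"
  by (simp add: avg_def sum_distrib_right)

lemma avg_sum: "avg A (\<lambda>x. \<Sum>i\<in>S. f i x) = (\<Sum>i\<in>S. avg A (f i))"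
  unfolding avg_def by (subst sum.swap) (simp add: sum_divide_distrib)

lemma avg_swap: "avg A (\<lambda>x. avg B (f x)) = avg B (\<lambda>y. avg A (\<lambda>x. f x y))"
  unfolding avg_def sum_divide_distrib[symmetric]
  by (subst sum.swap) (simp add: field_simps)

lemma avg_of_bool: "finite A \<Longrightarrow> avg A (\<lambda>x. of_bool (P x)) = card {x \<in> A. P x} / card A"
  by (simp add: avg_def Int_def)

text \<open>Jensen's inequality with equal weights: powers are convex on the nonnegative
  half-line.\<close>

lemma power_avg_le:
  assumes "finite A" "A \<noteq> {}" and nn: "\<And>x. x \<in> A \<Longrightarrow> 0 \<le> f x"
  shows "avg A f ^ n \<le> avg A (\<lambda>x. f x ^ n)"
proof -
  have "convex_on {0::real..} (\<lambda>x. x ^ n)"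
  proof (cases "even n")
    case True
    from convex_on_subset[OF convex_power_even[OF this]] show ?thesis
      by (auto simp: convex_real_interval)
  qed (rule convex_power_odd)
  from convex_on_sum[OF assms(1,2) this, of "\<lambda>_. 1 / card A" f] assms
  show ?thesis by (simp add: avg_def sum_divide_distrib)
qed

section \<open>Random functions with independent values\<close>

text \<open>Fubini: an extensional function on \<open>insert k I\<close> corresponds bijectively to
  its value at \<open>k\<close> together with its restriction to \<open>I\<close>.\<close>

lemma avg_PiE_insert:
  assumes "k \<notin> I"
  shows "avg (PiE (insert k I) B) f = avg (B k) (\<lambda>a. avg (PiE I B) (\<lambda>w. f (w(k := a))))"
proof -
  note inj = inj_combinator[OF assms, of B]
  have "(\<Sum>x\<in>PiE (insert k I) B. f x) = (\<Sum>a\<in>B k. \<Sum>w\<in>PiE I B. f (w(k := a)))"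
    unfolding PiE_insert_eq
    by (subst sum.reindex[OF inj]) (simp add: sum.cartesian_product case_prod_beta o_def)
  moreover have "card (PiE (insert k I) B) = card (B k) * card (PiE I B)"
    unfolding PiE_insert_eq by (subst card_image[OF inj]) (simp add: card_cartesian_product)
  ultimately show ?thesis
    by (simp add: avg_def sum_divide_distrib mult.commute)
qed

lemma avg_PiE_proj:
  assumes "k \<in> I" "finite I" "\<And>i. i \<in> I \<Longrightarrow> finite (B i) \<and> B i \<noteq> {}"
  shows "avg (PiE I B) (\<lambda>w. f (w k)) = avg (B k) f"
proof -
  have "PiE (I - {k}) B \<noteq> {}" "finite (PiE (I - {k}) B)"
    using assms by (auto simp: PiE_eq_empty_iff intro!: finite_PiE)
  then show ?thesis
    using avg_PiE_insert[of k "I - {k}" B "\<lambda>w. f (w k)"] assms(1)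
    by (simp add: insert_absorb avg_const)
qed

text \<open>Independence of the coordinates. Read from right to left, it turns a power of a density
  into an average over tuples, which is how a part gets blown up.\<close>

lemma avg_PiE_all:
  "avg (PiE {..<n} (\<lambda>_. A)) (\<lambda>g. of_bool (\<forall>j<n. Q (g j))) = avg A (\<lambda>a. of_bool (Q a)) ^ n"
proof (induction n)
  case 0
  then show ?case by (simp add: avg_def)
next
  case (Suc n)
  have split: "of_bool (\<forall>j<Suc n. Q ((g(n := a)) j)) =
      (of_bool (Q a) * of_bool (\<forall>j<n. Q (g j)) :: real)" for g a
    by (auto simp: less_Suc_eq)
  have "avg (PiE {..<Suc n} (\<lambda>_. A)) (\<lambda>g. of_bool (\<forall>j<Suc n. Q (g j)))
      = avg A (\<lambda>a. avg (PiE {..<n} (\<lambda>_. A)) (\<lambda>g. of_bool (Q a) * of_bool (\<forall>j<n. Q (g j))))"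
    unfolding lessThan_Suc split[symmetric] by (rule avg_PiE_insert) simp
  also have "\<dots> = avg A (\<lambda>a. of_bool (Q a)) ^ Suc n"
    unfolding avg_cmult Suc avg_multc power_Suc ..
  finally show ?case .
qed

text \<open>Once \<open>g a = x\<close> is fixed, \<open>g b\<close> is still uniform on
  \<open>A\<close>, so it hits \<open>x\<close> with probability \<open>1 / card A\<close>.\<close>

lemma avg_PiE_collision:
  fixes a b n :: nat
  assumes "finite A" "A \<noteq> {}" "a < n" "b < n" "a \<noteq> b"
  shows "avg (PiE {..<n} (\<lambda>_. A)) (\<lambda>g. of_bool (g a = g b)) = 1 / card A"
proof -
  have "avg (PiE {..<n} (\<lambda>_. A)) (\<lambda>g. of_bool (g a = g b))
     = avg A (\<lambda>x. avg (PiE ({..<n} - {a}) (\<lambda>_. A)) (\<lambda>g. of_bool (x = g b)))"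
    using avg_PiE_insert[of a "{..<n} - {a}" "\<lambda>_. A" "\<lambda>g. of_bool (g a = g b)"] assms
    by (simp add: insert_absorb)
  also have "\<dots> = avg A (\<lambda>x. avg A (\<lambda>y. of_bool (x = y)))"
    using assms by (intro avg_cong refl avg_PiE_proj) auto
  also have "\<dots> = avg A (\<lambda>x. 1 / card A)"
  proof (intro avg_cong refl)
    fix x assume "x \<in> A"
    then have "{y \<in> A. x = y} = {x}" by auto
    then show "avg A (\<lambda>y. of_bool (x = y)) = 1 / card A"
      using assms(1) by (simp add: avg_of_bool)
  qed
  finally show ?thesis using assms by (simp add: avg_const)
qed

section \<open>Blocks and their expected codegree\<close>

text \<open>Parts are tuples with repetitions allowed, not sets, so that the entries of a uniform
  block are independent.\<close>

definition blocks :: "'i set \<Rightarrow> ('i \<Rightarrow> nat) \<Rightarrow> ('i \<Rightarrow> 'a set) \<Rightarrow> ('i \<Rightarrow> nat \<Rightarrow> 'a) set" where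
  "blocks I s V = (\<Pi>\<^sub>E i\<in>I. {..<s i} \<rightarrow>\<^sub>E V i)"

definition complete_on ::
    "'i set \<Rightarrow> ('i \<Rightarrow> nat) \<Rightarrow> (('i \<Rightarrow> 'a) \<Rightarrow> bool) \<Rightarrow> ('i \<Rightarrow> nat \<Rightarrow> 'a) \<Rightarrow> bool" where
  "complete_on I s P X \<longleftrightarrow> (\<forall>w \<in> (\<Pi>\<^sub>E i\<in>I. X i ` {..<s i}). P w)"

text \<open>Adding a part \<open>g\<close> amounts to passing to the common link of its entries,
  which is again a predicate on \<open>I\<close>. Hence the induction below is generalized over
  \<open>P\<close>.\<close>

lemma complete_on_insert:
  assumes "k \<notin> I"
  shows "complete_on (insert k I) s P (X(k := g)) \<longleftrightarrow>
         complete_on I s (\<lambda>w. \<forall>j<s k. P (w(k := g j))) X"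
proof -
  have "(\<Pi>\<^sub>E i\<in>I. (X(k := g)) i ` {..<s i}) = (\<Pi>\<^sub>E i\<in>I. X i ` {..<s i})"
    using assms by (intro PiE_cong) auto
  then show ?thesis
    unfolding complete_on_def PiE_insert_eq by auto
qed

text \<open>The Sidorenko property of complete multipartite hypergraphs. One part is blown up at a time,
  and each blow-up costs one application of Jensen's inequality.\<close>

lemma density_power_le_avg_complete:
  assumes "finite I" "\<And>i. i \<in> I \<Longrightarrow> finite (V i) \<and> V i \<noteq> {}"
  shows "avg (PiE I V) (\<lambda>w. of_bool (P w)) ^ (\<Prod>i\<in>I. s i)
       \<le> avg (blocks I s V) (\<lambda>X. of_bool (complete_on I s P X))"
  using assms
proof (induction I arbitrary: P rule: finite_induct)
  case empty
  then show ?case by (simp add: blocks_def complete_on_def avg_def)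
next
  case (insert k I)
  define S where "S = (\<Prod>i\<in>I. s i)"
  define G where "G = {..<s k} \<rightarrow>\<^sub>E V k"
  define W where "W = PiE I V"
  have G: "finite G" "G \<noteq> {}" and W: "finite W" "W \<noteq> {}"
    using insert.hyps insert.prems
    by (auto simp: G_def W_def PiE_eq_empty_iff intro!: finite_PiE)
  have "avg (PiE (insert k I) V) (\<lambda>w. of_bool (P w)) ^ (\<Prod>i\<in>insert k I. s i)
      = (avg W (\<lambda>w. avg (V k) (\<lambda>a. of_bool (P (w(k := a))))) ^ s k) ^ S"
    using insert.hyps unfolding avg_PiE_insert[OF insert.hyps(2)] S_def W_def
    by (subst avg_swap) (simp add: power_mult)
  \<comment> \<open>Jensen over \<open>w\<close>, applied to the density of extensions of
    \<open>w\<close> by a vertex of \<open>V k\<close>.\<close>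
  also have "\<dots> \<le> avg W (\<lambda>w. avg (V k) (\<lambda>a. of_bool (P (w(k := a)))) ^ s k) ^ S"
    using W by (intro power_mono power_avg_le zero_le_power avg_nonneg) auto
  also have "\<dots> = avg G (\<lambda>g. avg W (\<lambda>w. of_bool (\<forall>j<s k. P (w(k := g j))))) ^ S"
    unfolding G_def avg_PiE_all[symmetric] by (subst avg_swap) simp
  \<comment> \<open>Jensen over \<open>g\<close>, so that the induction hypothesis applies to the
    common link of each tuple \<open>g\<close> separately.\<close>
  also have "\<dots> \<le> avg G (\<lambda>g. avg W (\<lambda>w. of_bool (\<forall>j<s k. P (w(k := g j)))) ^ S)"
    using G by (intro power_avg_le avg_nonneg) auto
  also have "\<dots> \<le> avg G (\<lambda>g. avg (blocks I s V)
        (\<lambda>X. of_bool (complete_on I s (\<lambda>w. \<forall>j<s k. P (w(k := g j))) X)))"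
    unfolding S_def W_def using insert by (intro avg_mono insert.IH) auto
  also have "\<dots> = avg (blocks (insert k I) s V) (\<lambda>X. of_bool (complete_on (insert k I) s P X))"
    unfolding blocks_def avg_PiE_insert[OF insert.hyps(2)] complete_on_insert[OF insert.hyps(2)]
      G_def ..
  finally show ?case .
qed

text \<open>Degenerate blocks are bounded trivially: two entries of a block in \<^term>\<open>V i\<close> coincide with
  probability \<^term>\<open>1 / card (V i)\<close>, which cancels the trivial codegree bound \<^term>\<open>card Y\<close>. This is
  where the last part has to be the smallest one.\<close>

lemma density_power_bound:
  fixes P :: "'b \<Rightarrow> ('i \<Rightarrow> 'a) \<Rightarrow> bool"
  assumes I: "finite I" and V: "\<And>i. i \<in> I \<Longrightarrow> finite (V i)"
    and Y: "finite Y" "Y \<noteq> {}" and le: "\<And>i. i \<in> I \<Longrightarrow> card Y \<le> card (V i)"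
    and codegree: "\<And>X. X \<in> blocks I s V \<Longrightarrow> (\<And>i. i \<in> I \<Longrightarrow> inj_on (X i) {..<s i}) \<Longrightarrow>
        card {y \<in> Y. complete_on I s (P y) X} \<le> t"
  shows "card Y * avg Y (\<lambda>y. avg (PiE I V) (\<lambda>w. of_bool (P y w))) ^ (\<Prod>i\<in>I. s i)
       \<le> t + (\<Sum>i\<in>I. real (s i) ^ 2)"
proof -
  have Vne: "V i \<noteq> {}" if "i \<in> I" for i
    using le[OF that] Y by auto
  define B where "B = blocks I s V"
  have B: "finite B" "B \<noteq> {}"
    using I V Vne by (auto simp: B_def blocks_def PiE_eq_empty_iff intro!: finite_PiE)
  \<comment> \<open>The number of coinciding pairs of entries in part \<open>i\<close>. It is at
    least 1 as soon as \<open>X i\<close> fails to be injective, so it dominates the indicator of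
    degeneracy.\<close>
  define D :: "'i \<Rightarrow> ('i \<Rightarrow> nat \<Rightarrow> 'a) \<Rightarrow> real"
    where "D i X = (\<Sum>a<s i. \<Sum>b<a. of_bool (X i a = X i b))" for i X
  have D_nonneg: "0 \<le> D i X" for i X
    unfolding D_def by (intro sum_nonneg) auto
  have pointwise: "card {y \<in> Y. complete_on I s (P y) X} \<le> t + card Y * (\<Sum>i\<in>I. D i X)"
    if X: "X \<in> B" for X
  proof (cases "\<forall>i\<in>I. inj_on (X i) {..<s i}")
    case True
    then have "card {y \<in> Y. complete_on I s (P y) X} \<le> t"
      using codegree X by (auto simp: B_def)
    moreover have "0 \<le> card Y * (\<Sum>i\<in>I. D i X)"
      by (intro mult_nonneg_nonneg sum_nonneg D_nonneg) simp
    ultimately show ?thesis by linarith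
  next
    case False
    then obtain i a b where i: "i \<in> I" and ab: "a < s i" "b < s i" "X i a = X i b" "a \<noteq> b"
      by (auto simp: inj_on_def)
    then obtain a b where ab: "a < s i" "b < a" "X i a = X i b"
      by (metis linorder_neqE_nat)
    have "(1::real) \<le> (\<Sum>b<a. of_bool (X i a = X i b))"
      using ab member_le_sum[of b "{..<a}" "\<lambda>b. of_bool (X i a = X i b) :: real"] by auto
    also have "\<dots> \<le> D i X"
      unfolding D_def using ab
      by (intro member_le_sum[of a _ "\<lambda>a. \<Sum>b<a. of_bool (X i a = X i b)"] sum_nonneg) auto
    also have "\<dots> \<le> (\<Sum>i\<in>I. D i X)"
      using i I D_nonneg by (intro member_le_sum) auto
    finally have "real (card Y) * 1 \<le> card Y * (\<Sum>i\<in>I. D i X)"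
      by (intro mult_left_mono) auto
    moreover have "card {y \<in> Y. complete_on I s (P y) X} \<le> card Y"
      using Y by (intro card_mono) auto
    ultimately show ?thesis by simp
  qed
  have avg_D: "card Y * avg B (D i) \<le> real (s i) ^ 2" if i: "i \<in> I" for i
  proof -
    have "avg B (D i) = avg ({..<s i} \<rightarrow>\<^sub>E V i) (\<lambda>g. \<Sum>a<s i. \<Sum>b<a. of_bool (g a = g b))"
      unfolding B_def blocks_def D_def using i I V Vne
      by (subst avg_PiE_proj[of i]) (auto simp: PiE_eq_empty_iff intro!: finite_PiE)
    also have "\<dots> = (\<Sum>a<s i. \<Sum>b<a. 1 / card (V i))"
      unfolding avg_sum using V[OF i] Vne[OF i]
      by (intro sum.cong avg_PiE_collision) auto
    also have "card Y * \<dots> = (\<Sum>a<s i. \<Sum>b<a. card Y / card (V i))"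
      by (simp add: sum_distrib_left mult.commute)
    also have "\<dots> \<le> (\<Sum>a<s i. \<Sum>b<a. 1)"
      using le[OF i] by (intro sum_mono) (simp add: divide_le_eq)
    \<comment> \<open>A crude count of pairs suffices, as the constant may depend on
      \<open>s\<close>.\<close>
    also have "\<dots> \<le> (\<Sum>a<s i. real (s i))"
      by (intro sum_mono) auto
    finally show ?thesis by (simp add: power2_eq_square)
  qed
  \<comment> \<open>Jensen over \<open>y\<close> passes from the overall density to the individual
    link densities.\<close>
  have "card Y * avg Y (\<lambda>y. avg (PiE I V) (\<lambda>w. of_bool (P y w))) ^ (\<Prod>i\<in>I. s i)
      \<le> card Y * avg Y (\<lambda>y. avg (PiE I V) (\<lambda>w. of_bool (P y w)) ^ (\<Prod>i\<in>I. s i))"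
    using Y by (intro mult_left_mono power_avg_le avg_nonneg) auto
  also have "\<dots> \<le> card Y * avg Y (\<lambda>y. avg B (\<lambda>X. of_bool (complete_on I s (P y) X)))"
    unfolding B_def using I V Vne
    by (intro mult_left_mono avg_mono density_power_le_avg_complete) auto
  \<comment> \<open>Double counting: exchanging the averages gives the expected codegree of a random
    block.\<close>
  also have "\<dots> = avg B (\<lambda>X. real (card {y \<in> Y. complete_on I s (P y) X}))"
    using Y by (subst avg_swap) (simp add: avg_of_bool avg_cmult[symmetric])
  also have "\<dots> \<le> avg B (\<lambda>X. t + card Y * (\<Sum>i\<in>I. D i X))"
    by (intro avg_mono pointwise)
  also have "\<dots> = t + (\<Sum>i\<in>I. card Y * avg B (D i))"
    using B by (simp add: avg_add avg_const avg_cmult avg_sum sum_distrib_left)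
  also have "\<dots> \<le> t + (\<Sum>i\<in>I. real (s i) ^ 2)"
    by (intro add_left_mono sum_mono avg_D)
  finally show ?thesis .
qed

text \<open>Every edge arises from its vertex \<open>y\<close> in the last part and a transversal
  \<open>w\<close> in the link of \<open>y\<close>; surjectivity of this map gives the
  bound.\<close>

lemma r_partite_card_hyperedges_le:
  assumes H: "r_partite r H V" and r: "r \<ge> 1"
  shows "card (hyperedges H)
       \<le> (\<Sum>y\<in>V r. card {w \<in> PiE {1..r-1} V. (w(r := y)) ` {1..r} \<in> hyperedges H})"
proof -
  have fin: "finite (V i)" if "i \<in> {1..r}" for i
    using H that by (auto simp: r_partite_def r_graph_def)
  have finW: "finite (PiE {1..r-1} V)"
    using fin by (intro finite_PiE) auto
  define T where "T = (SIGMA y:V r. {w \<in> PiE {1..r-1} V. (w(r := y)) ` {1..r} \<in> hyperedges H})"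
  have "hyperedges H \<subseteq> (\<lambda>(y, w). (w(r := y)) ` {1..r}) ` T"
  proof
    fix e assume e: "e \<in> hyperedges H"
    then have "\<forall>i\<in>{1..r}. \<exists>x. e \<inter> V i = {x}"
      using H by (auto simp: r_partite_def card_1_singleton_iff)
    then obtain v where v: "\<And>i. i \<in> {1..r} \<Longrightarrow> e \<inter> V i = {v i}"
      by metis
    have "e \<subseteq> (\<Union>i\<in>{1..r}. V i)"
      using H e by (auto simp: r_partite_def r_graph_def)
    then have "e = (\<Union>i\<in>{1..r}. e \<inter> V i)"
      by auto
    also have "\<dots> = v ` {1..r}"
      using v by auto
    \<comment> \<open>Restricting makes the transversal extensional, as \<open>PiE\<close> demands;
      the update restores the value at \<open>r\<close>.\<close>
    also have "\<dots> = ((restrict v {1..r-1})(r := v r)) ` {1..r}"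
      by (intro image_cong) auto
    finally have e_eq: "e = ((restrict v {1..r-1})(r := v r)) ` {1..r}" .
    have "v i \<in> V i" if "i \<in> {1..r}" for i
      using v[OF that] by auto
    then have "(v r, restrict v {1..r-1}) \<in> T"
      unfolding T_def mem_Sigma_iff mem_Collect_eq e_eq[symmetric] using r e by auto
    then show "e \<in> (\<lambda>(y, w). (w(r := y)) ` {1..r}) ` T"
      using e_eq by (intro image_eqI[of _ _ "(v r, restrict v {1..r-1})"]) auto
  qed
  moreover have "finite T"
    unfolding T_def using fin r finW by (intro finite_SigmaI finite_Collect_conjI disjI1) auto
  ultimately have "card (hyperedges H) \<le> card T"
    by (rule surj_card_le[rotated])
  also have "card T = (\<Sum>y\<in>V r. card {w \<in> PiE {1..r-1} V. (w(r := y)) ` {1..r} \<in> hyperedges H})"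
    unfolding T_def using fin r finW by (intro card_SigmaI ballI finite_Collect_conjI disjI1) auto
  finally show ?thesis .
qed

section \<open>Bounding the edges of an extremal hypergraph\<close>

theorem corollary1p2:
  fixes r :: nat and s :: "nat \<Rightarrow> nat"
  assumes "r \<ge> 2" and "\<forall>i\<in>{1..r}. s i > 0"
  shows "\<exists>C::real. C > 0 \<and>
    (\<forall>m :: nat \<Rightarrow> nat.
       (\<forall>i\<in>{1..r}. m i > 0) \<longrightarrow> (\<forall>i\<in>{1..r-1}. m i \<ge> m r) \<longrightarrow>
       real (zarankiewicz r m s)
         \<le> C * (\<Prod>i=1..r-1. real (m i)) *
             real (m r) powr (1 - 1 / (\<Prod>i=1..r-1. real (s i))))"
proof -
  define I where "I = {1..r-1}"
  define S where "S = (\<Prod>i\<in>I. s i)"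
  \<comment> \<open>The bound on \<open>m r * p ^ S\<close> for edge density \<open>p\<close>:
    codegree \<open>s r\<close> plus the cost of degenerate blocks. Its \<open>S\<close>-th root is
    the final constant.\<close>
  define K where "K = s r + (\<Sum>i\<in>I. real (s i) ^ 2)"
  have S: "S > 0"
    using assms by (auto simp: S_def I_def intro!: prod_pos)
  have K: "K > 0"
    using assms by (auto simp: K_def intro!: add_pos_nonneg sum_nonneg)
  have bound: "real (zarankiewicz r m s)
      \<le> K powr (1 / S) * (\<Prod>i\<in>I. real (m i)) * real (m r) powr (1 - 1 / S)"
    if m: "\<forall>i\<in>{1..r}. m i > 0" and m_ge: "\<forall>i\<in>I. m i \<ge> m r" for m
  proof -
    obtain H :: "nat hypergraph" and V where Z: "zarankiewicz_graph r m s H V"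
      and card: "card (hyperedges H) = zarankiewicz r m s"
      using zarankiewicz_attained[of r s m] assms by auto
    have part: "r_partite r H V" and cV: "\<And>i. i \<in> {1..r} \<Longrightarrow> card (V i) = m i"
      and free: "\<not> contains_ordered_complete r H V s"
      using Z by (auto simp: zarankiewicz_graph_def)
    have fin: "finite (V i)" if "i \<in> {1..r}" for i
      using cV[OF that] m that card_ge_0_finite by metis
    define P where "P y w \<longleftrightarrow> (w(r := y)) ` {1..r} \<in> hyperedges H" for y w
    have r: "r \<in> {1..r}" and I: "I \<subseteq> {1..r}" "finite I"
      using assms by (auto simp: I_def)
    have cVr: "card (V r) = m r" and m_pos: "m r > 0"
      using cV r m by auto
    \<comment> \<open>If \<open>s r\<close> vertices had a nondegenerate block in their links, they
      would form with it an ordered complete subgraph. So the codegree is even below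
      \<open>s r\<close>; the weak bound is enough.\<close>
    have codegree: "card {y \<in> V r. complete_on I s (P y) X} \<le> s r"
      if X: "X \<in> blocks I s V" and inj: "\<And>i. i \<in> I \<Longrightarrow> inj_on (X i) {..<s i}" for X
    proof (rule ccontr)
      assume "\<not> card {y \<in> V r. complete_on I s (P y) X} \<le> s r"
      then have "s r \<le> card {y \<in> V r. complete_on I s (P y) X}"
        by simp
      then obtain Q where Q: "Q \<subseteq> {y \<in> V r. complete_on I s (P y) X}" "card Q = s r"
        by (rule obtain_subset_with_card_n)
      define R where "R i = (if i = r then Q else X i ` {..<s i})" for i
      have "R i \<subseteq> V i \<and> card (R i) = s i" if i: "i \<in> {1..r}" for i
      proof (cases "i = r")
        case False
        then have "i \<in> I" using i by (auto simp: I_def)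
        then have "X i \<in> {..<s i} \<rightarrow>\<^sub>E V i" "card (X i ` {..<s i}) = s i"
          using X inj[of i] by (auto simp: blocks_def card_image)
        then show ?thesis using False by (auto simp: R_def)
      qed (use Q in \<open>auto simp: R_def\<close>)
      moreover have "v ` {1..r} \<in> hyperedges H" if v: "\<forall>i\<in>{1..r}. v i \<in> R i" for v
      proof -
        have "complete_on I s (P (v r)) X"
          using bspec[OF v r] Q by (auto simp: R_def)
        moreover have "restrict v I \<in> (\<Pi>\<^sub>E i\<in>I. X i ` {..<s i})"
        proof (rule restrict_PiE_iff[THEN iffD2], rule ballI)
          fix i assume i: "i \<in> I"
          then have "i \<noteq> r" using assms by (auto simp: I_def)
          then show "v i \<in> X i ` {..<s i}"
            using bspec[OF v subsetD[OF I(1) i]] by (simp add: R_def)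
        qed
        ultimately have "((restrict v I)(r := v r)) ` {1..r} \<in> hyperedges H"
          unfolding complete_on_def P_def by (rule bspec)
        moreover have "((restrict v I)(r := v r)) ` {1..r} = v ` {1..r}"
          by (intro image_cong) (auto simp: I_def)
        ultimately show ?thesis by simp
      qed
      ultimately show False
        using free unfolding contains_ordered_complete_def by blast
    qed
    define M where "M = (\<Prod>i\<in>I. real (m i))"
    have M: "M > 0"
      unfolding M_def using m I by (intro prod_pos) auto
    have cW: "card (PiE I V) = M"
      unfolding M_def using I cV by (auto simp: card_PiE intro!: prod.cong)
    define p where "p = avg (V r) (\<lambda>y. avg (PiE I V) (\<lambda>w. of_bool (P y w)))"
    have p: "p \<ge> 0"
      unfolding p_def by (intro avg_nonneg) auto
    have finW: "finite (PiE I V)"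
      using I fin by (intro finite_PiE) auto
    have "V r \<noteq> {}"
      using cVr m_pos by auto
    then have "m r * p ^ S \<le> K"
      unfolding cVr[symmetric] p_def S_def K_def
      using I fin r m_ge cV codegree by (intro density_power_bound) auto
    then have "p ^ S \<le> K / m r"
      using m_pos by (simp add: field_simps)
    then have "(p ^ S) powr (1 / S) \<le> (K / m r) powr (1 / S)"
      using p by (intro powr_mono2) auto
    \<comment> \<open>The case \<open>p = 0\<close> is separate because rewriting
      \<open>p ^ S\<close> as a real power needs a positive base.\<close>
    then have p_le: "p \<le> (K / m r) powr (1 / S)"
      using p S by (cases "p = 0") (simp_all add: powr_realpow[symmetric] powr_powr)
    have "real (zarankiewicz r m s) \<le> real (\<Sum>y\<in>V r. card {w \<in> PiE I V. P y w})"
      using r_partite_card_hyperedges_le[OF part] assms(1)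
      unfolding card P_def I_def by (intro of_nat_mono) linarith
    also have "\<dots> = M * m r * p"
      using M m_pos finW by (simp add: p_def avg_def cW cVr Int_def sum_divide_distrib[symmetric])
    also have "\<dots> \<le> M * m r * (K / m r) powr (1 / S)"
      using M p_le by (intro mult_left_mono) auto
    \<comment> \<open>The factor \<open>m r\<close> and the root of \<open>1 / m r\<close> combine
      to the exponent \<open>1 - 1 / S\<close>.\<close>
    also have "\<dots> = K powr (1 / S) * M * real (m r) powr (1 - 1 / S)"
      using K m_pos by (simp add: powr_divide powr_diff)
    finally show ?thesis unfolding M_def .
  qed
  have "real S = (\<Prod>i=1..r-1. real (s i))"
    by (simp add: S_def I_def)
  with bound K show ?thesis
    unfolding I_def by (intro exI[of _ "K powr (1 / S)"]) auto
qed

end
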